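(* Let $P$ be a disjunctive program. Then every (disjunctive) stable model of $P$ is a minimal founded model of $P$, i.e. $\mathcal{SM}(P) \subseteq \mathcal{MF}(P)$.
   Context: A disjunctive (datalog) rule has the form $A_1 \vee \cdots \vee A_k \leftarrow B_1,\ldots,B_m,\neg C_1,\ldots,\neg C_n$ with $k+m+n>0$, where all $A_i,B_j,C_l$ are function-free atoms $p(t_1,\ldots,t_h)$ whose terms are constants or variables; $Head(r)=\{A_1,\ldots,A_k\}$, $Body(r)=\{B_1,\ldots,B_m,\neg C_1,\ldots,\neg C_n\}$. Rules with empty head ($k=0$) are called denials. A disjunctive program is a finite set of rules; it is positive if it contains no negation and normal if every rule has $k=1$. $U_P$ is the set of constants in $P$, $B_P$ the set of ground atoms built from predicates of $P$ and constants of $U_P$, and $ground(P)$ the set of all ground instances of rules of $P$ over $U_P$. An interpretation is a subset $I\subseteq B_P$; a ground rule $r$ is satisfied by $I$ if some head atom is in $I$ or the body is false in $I$ (so a denial is satisfied iff its body is false). A model is an interpretation satisfying every rule of $ground(P)$; $\mathcal{MM}(P)$ denotes the set of minimal models (w.r.t. set inclusion). For an interpretation $M$, $\frac{P}{M}$ is the positive ground program obtained from $ground(P)$ by deleting every rule containing a literal $\neg a$ with $a\in M$ and deleting all negative literals from the remaining rules. $M$ is a stable model of $P$ iff $M\in\mathcal{MM}(\frac{P}{M})$; $\mathcal{SM}(P)$ is the set of stable models. For a positive program $Q$, $S_Q(M)=\{a\in B_Q \mid \exists r\in ground(Q): a\in Head(r) \wedge Body(r)\subseteq M\}$, and $S_Q^\omega(\emptyset)$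 is its least fixpoint. A model $M$ of $P$ is founded if $M\subseteq S_{\frac{P}{M}}^\omega(\emptyset)$; it is minimal founded if it is a minimal model of $P$ and founded. $\mathcal{MF}(P)$ is the set of minimal founded models. *)

theory Defs
  imports Main "HOL-Library.Order_Continuity"
begin

datatype (trm_consts: 'c, trm_vars: 'v) trm = Const 'c | Var 'v

datatype ('p, atom_consts: 'c, atom_vars: 'v) atom =
  Atom (pred_of: 'p) (args: "('c, 'v) trm list")

text \<open>\<open>Rule [A1, ..., Ak] [B1, ..., Bm] [C1, ..., Cn]\<close> stands for the rule
  \<open>A1 \<or> ... \<or> Ak \<leftarrow> B1, ..., Bm, \<not> C1, ..., \<not> Cn\<close>.\<close>

datatype ('p, rule_consts: 'c, rule_vars: 'v) rule =
  Rule (head: "('p, 'c, 'v) atom list")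
       (pos_body: "('p, 'c, 'v) atom list")
       (neg_body: "('p, 'c, 'v) atom list")

type_synonym ('p, 'c, 'v) program = "('p, 'c, 'v) rule set"

definition disjunctive_program :: "('p, 'c, 'v) program \<Rightarrow> bool" where
  "disjunctive_program P \<longleftrightarrow> finite P \<and>
     (\<forall>r\<in>P. length (head r) + length (pos_body r) + length (neg_body r) > 0)"

definition rule_atoms :: "('p, 'c, 'v) rule \<Rightarrow> ('p, 'c, 'v) atom set" where
  "rule_atoms r = set (head r) \<union> set (pos_body r) \<union> set (neg_body r)"

text \<open>A predicate is identified by its name together with its arity.\<close>

definition predicates :: "('p, 'c, 'v) program \<Rightarrow> ('p \<times> nat) set" where
  "predicates P = {(pred_of a, length (args a)) | a r. r \<in> P \<and> a \<in> rule_atoms r}"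

definition herbrand_universe :: "('p, 'c, 'v) program \<Rightarrow> 'c set" where
  "herbrand_universe P = (\<Union>r\<in>P. rule_consts r)"

definition herbrand_base :: "('p, 'c, 'v) program \<Rightarrow> ('p, 'c, 'v) atom set" where
  "herbrand_base P =
     {Atom p (map Const cs) | p cs.
        (p, length cs) \<in> predicates P \<and> set cs \<subseteq> herbrand_universe P}"

fun subst_trm :: "('v \<Rightarrow> 'c) \<Rightarrow> ('c, 'v) trm \<Rightarrow> ('c, 'v) trm" where
  "subst_trm \<sigma> (Const c) = Const c"
| "subst_trm \<sigma> (Var v) = Const (\<sigma> v)"

definition subst_atom :: "('v \<Rightarrow> 'c) \<Rightarrow> ('p, 'c, 'v) atom \<Rightarrow> ('p, 'c, 'v) atom" where
  "subst_atom \<sigma> a = Atom (pred_of a) (map (subst_trm \<sigma>) (args a))"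

definition subst_rule :: "('v \<Rightarrow> 'c) \<Rightarrow> ('p, 'c, 'v) rule \<Rightarrow> ('p, 'c, 'v) rule" where
  "subst_rule \<sigma> r = Rule (map (subst_atom \<sigma>) (head r))
     (map (subst_atom \<sigma>) (pos_body r)) (map (subst_atom \<sigma>) (neg_body r))"

text \<open>The substitution is constrained only on the variables of the rule, so that variable-free
  rules are kept even when the program contains no constants.\<close>

definition ground :: "('p, 'c, 'v) program \<Rightarrow> ('p, 'c, 'v) program" where
  "ground P = {subst_rule \<sigma> r | \<sigma> r.
     r \<in> P \<and> (\<forall>v\<in>rule_vars r. \<sigma> v \<in> herbrand_universe P)}"

definition interpretation_of :: "('p, 'c, 'v) program \<Rightarrow> ('p, 'c, 'v) atom set \<Rightarrow> bool" where
  "interpretation_of P I \<longleftrightarrow> I \<subseteq> herbrand_base P"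

definition body_true :: "('p, 'c, 'v) atom set \<Rightarrow> ('p, 'c, 'v) rule \<Rightarrow> bool" where
  "body_true I r \<longleftrightarrow> (\<forall>b\<in>set (pos_body r). b \<in> I) \<and> (\<forall>c\<in>set (neg_body r). c \<notin> I)"

definition satisfies :: "('p, 'c, 'v) atom set \<Rightarrow> ('p, 'c, 'v) rule \<Rightarrow> bool" where
  "satisfies I r \<longleftrightarrow> (\<exists>a\<in>set (head r). a \<in> I) \<or> \<not> body_true I r"

definition model :: "('p, 'c, 'v) program \<Rightarrow> ('p, 'c, 'v) atom set \<Rightarrow> bool" where
  "model P M \<longleftrightarrow> interpretation_of P M \<and> (\<forall>r\<in>ground P. satisfies M r)"

definition MM :: "('p, 'c, 'v) program \<Rightarrow> ('p, 'c, 'v) atom set set" where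
  "MM P = {M. model P M \<and> \<not> (\<exists>N. model P N \<and> N \<subset> M)}"

text \<open>A denial \<open>\<leftarrow> \<not> C1, ..., \<not> Cn\<close> that survives the reduction becomes the empty rule, which no
  interpretation satisfies.\<close>

definition reduct :: "('p, 'c, 'v) program \<Rightarrow> ('p, 'c, 'v) atom set \<Rightarrow> ('p, 'c, 'v) program" where
  "reduct P M = {Rule (head r) (pos_body r) [] | r.
     r \<in> ground P \<and> \<not> (\<exists>a\<in>set (neg_body r). a \<in> M)}"

definition SM :: "('p, 'c, 'v) program \<Rightarrow> ('p, 'c, 'v) atom set set" where
  "SM P = {M. interpretation_of P M \<and> M \<in> MM (reduct P M)}"

text \<open>Meant for positive programs only, where the body of a rule is its positive body.\<close>

definition S_op :: "('p, 'c, 'v) program \<Rightarrow> ('p, 'c, 'v) atom set \<Rightarrow> ('p, 'c, 'v) atom set" where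
  "S_op Q M = {a \<in> herbrand_base Q. \<exists>r\<in>ground Q. a \<in> set (head r) \<and> set (pos_body r) \<subseteq> M}"

definition S_omega :: "('p, 'c, 'v) program \<Rightarrow> ('p, 'c, 'v) atom set" where
  "S_omega Q = lfp (S_op Q)"

lemma mono_S_op: "mono (S_op Q)"
  unfolding mono_def S_op_def by blast

lemma S_op_S_omega: "S_op Q (S_omega Q) = S_omega Q"
  unfolding S_omega_def by (rule lfp_unfold[OF mono_S_op, symmetric])

lemma S_omega_iterate:
  fixes Q :: "('p, 'c, 'v) program"
  shows "S_omega Q = (\<Union>n. (S_op Q ^^ n) {})"
proof -
  have "sup_continuous (S_op Q)"
  unfolding sup_continuous_def
  proof (intro allI impI)
    fix M :: "nat \<Rightarrow> ('p, 'c, 'v) atom set"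
    assume M: "incseq M"
    show "S_op Q (\<Union>i. M i) = (\<Union>i. S_op Q (M i))"
    proof (rule equalityI)
      show "S_op Q (\<Union>i. M i) \<subseteq> (\<Union>i. S_op Q (M i))"
      proof
        fix a
        assume "a \<in> S_op Q (\<Union>i. M i)"
        then obtain r where r: "a \<in> herbrand_base Q" "r \<in> ground Q" "a \<in> set (head r)"
          and sub: "set (pos_body r) \<subseteq> (\<Union>i. M i)"
          unfolding S_op_def by blast
        have "\<exists>i. set bs \<subseteq> M i" if "set bs \<subseteq> (\<Union>i. M i)" for bs
          using that
        proof (induction bs)
          case (Cons b bs)
          then obtain i j where ij: "set bs \<subseteq> M i" "b \<in> M j" by auto
          have "M i \<subseteq> M (max i j)" "M j \<subseteq> M (max i j)"
            using M by (simp_all add: incseq_def)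
          with ij have "set (b # bs) \<subseteq> M (max i j)" by auto
          then show ?case ..
        qed simp
        with sub obtain i where "set (pos_body r) \<subseteq> M i" by blast
        with r show "a \<in> (\<Union>i. S_op Q (M i))" unfolding S_op_def by blast
      qed
    qed (auto simp: S_op_def)
  qed
  then show ?thesis
    unfolding S_omega_def by (simp add: sup_continuous_lfp)
qed

definition founded :: "('p, 'c, 'v) program \<Rightarrow> ('p, 'c, 'v) atom set \<Rightarrow> bool" where
  "founded P M \<longleftrightarrow> model P M \<and> M \<subseteq> S_omega (reduct P M)"

definition MF :: "('p, 'c, 'v) program \<Rightarrow> ('p, 'c, 'v) atom set set" where
  "MF P = {M. M \<in> MM P \<and> founded P M}"

end

theory Submission
  imports Defs
begin

text \<open>The reduct is ground and positive, so it is its own grounding. If \<open>M\<close> is stable, a model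
  \<open>N \<subset> M\<close> of \<open>P\<close> would also be a model of the reduct with respect to \<open>M\<close>, because the
  negative literals that are true in \<open>M\<close> are true in \<open>N\<close> as well; hence \<open>M\<close> is a minimal model
  of \<open>P\<close>. For foundedness, \<open>M \<inter> S_omega (reduct P M)\<close> is again a model of the reduct,
  so it equals \<open>M\<close> by minimality.\<close>

lemma subst_trm_closed: "trm_vars t = {} \<Longrightarrow> subst_trm \<sigma> t = t"
  by (cases t) auto

lemma trm_vars_subst_trm [simp]: "trm_vars (subst_trm \<sigma> t) = {}"
  by (cases t) auto

lemma subst_atom_closed: "atom_vars a = {} \<Longrightarrow> subst_atom \<sigma> a = a"
  by (cases a) (auto simp: subst_atom_def subst_trm_closed intro!: map_idI)

lemma atom_vars_subst_atom [simp]: "atom_vars (subst_atom \<sigma> a) = {}"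
  by (simp add: subst_atom_def)

lemma subst_rule_closed: "rule_vars r = {} \<Longrightarrow> subst_rule \<sigma> r = r"
  by (cases r) (auto simp: subst_rule_def subst_atom_closed intro!: map_idI)

lemma rule_vars_reduct:
  assumes "r \<in> reduct P M"
  shows "rule_vars r = {}"
  using assms by (auto simp: reduct_def ground_def subst_rule_def)

lemma ground_closed:
  assumes "\<And>r. r \<in> Q \<Longrightarrow> rule_vars r = {}"
  shows "ground Q = Q"
proof (intro equalityI subsetI)
  fix r
  assume "r \<in> ground Q"
  then show "r \<in> Q" using assms by (auto simp: ground_def subst_rule_closed)
next
  fix r
  assume "r \<in> Q"
  moreover from this have "rule_vars r = {}" by (rule assms)
  \<comment> \<open>Any substitution will do: \<open>r\<close> has no variables, so the side
    condition in \<open>ground\<close> is vacuous even if the Herbrand universe is empty.\<close>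
  moreover from this have "r = subst_rule undefined r" by (simp add: subst_rule_closed)
  ultimately show "r \<in> ground Q" unfolding ground_def by blast
qed

lemma ground_reduct: "ground (reduct P M) = reduct P M"
  by (rule ground_closed) (rule rule_vars_reduct)

lemma satisfies_reduct_mono:
  assumes "\<forall>r\<in>ground P. satisfies N r" and "N \<subseteq> M" and "r \<in> reduct P M"
  shows "satisfies N r"
  using assms by (fastforce simp: reduct_def satisfies_def body_true_def)

text \<open>A rule deleted by the reduction has a body false in \<open>M\<close>; a surviving rule
  has the same truth value in \<open>M\<close> as its reduced form.\<close>

lemma satisfies_of_reduct:
  assumes "\<forall>r\<in>reduct P M. satisfies M r" and "r \<in> ground P"
  shows "satisfies M r"
proof (cases "\<exists>a\<in>set (neg_body r). a \<in> M")
  case True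
  then show ?thesis by (auto simp: satisfies_def body_true_def)
next
  case False
  with assms(2) have "Rule (head r) (pos_body r) [] \<in> reduct P M"
    by (auto simp: reduct_def)
  with assms(1) have "satisfies M (Rule (head r) (pos_body r) [])" by blast
  then show ?thesis by (auto simp: satisfies_def body_true_def)
qed

text \<open>If the body of a rule lies in the intersection, \<open>M\<close> supplies a true head
  atom, and one application of \<open>S_op\<close> puts that atom into the fixpoint as well.\<close>

lemma model_Int_S_omega:
  assumes positive: "\<And>r. r \<in> ground Q \<Longrightarrow> neg_body r = []" and "model Q M"
  shows "model Q (M \<inter> S_omega Q)"
  unfolding model_def
proof (intro conjI ballI)
  show "interpretation_of Q (M \<inter> S_omega Q)"
    using assms(2) by (auto simp: model_def interpretation_of_def)
next
  fix r
  assume r: "r \<in> ground Q"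
  show "satisfies (M \<inter> S_omega Q) r"
  proof (cases "set (pos_body r) \<subseteq> M \<inter> S_omega Q")
    case True
    moreover have "satisfies M r" using assms(2) r by (simp add: model_def)
    ultimately obtain a where a: "a \<in> set (head r)" "a \<in> M"
      using positive[OF r] by (auto simp: satisfies_def body_true_def)
    \<comment> \<open>\<open>S_op\<close> derives only atoms of the Herbrand base.\<close>
    have "a \<in> herbrand_base Q"
      using a assms(2) by (auto simp: model_def interpretation_of_def)
    with r a True have "a \<in> S_op Q (S_omega Q)" unfolding S_op_def by blast
    with a show ?thesis by (auto simp: satisfies_def S_op_S_omega)
  next
    case False
    then show ?thesis by (auto simp: satisfies_def body_true_def)
  qed
qed

lemma minimal_model_subset_S_omega:
  assumes "\<And>r. r \<in> ground Q \<Longrightarrow> neg_body r = []" and "M \<in> MM Q"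
  shows "M \<subseteq> S_omega Q"
  using model_Int_S_omega[of Q M] assms by (auto simp: MM_def)

theorem theorem1:
  fixes P :: "('p, 'c, 'v) program"
  assumes "disjunctive_program P"
  shows "SM P \<subseteq> MF P"
proof
  fix M
  assume "M \<in> SM P"
  then have int: "interpretation_of P M" and min: "M \<in> MM (reduct P M)"
    by (auto simp: SM_def)
  from min have M: "model (reduct P M) M"
    and minD: "\<And>N. model (reduct P M) N \<Longrightarrow> \<not> N \<subset> M"
    by (auto simp: MM_def)
  have mod: "model P M"
    using int M satisfies_of_reduct by (auto simp: model_def ground_reduct)
  have "\<not> N \<subset> M" if N: "model P N" for N
  proof
    assume "N \<subset> M"
    \<comment> \<open>The reduct may have lost predicates or constants of \<open>P\<close>, so that
      \<open>N\<close> lies in its Herbrand base is inferred from \<open>N \<subset> M\<close>, not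
      from \<open>N\<close> being an interpretation of \<open>P\<close>.\<close>
    moreover have "model (reduct P M) N"
      using N M \<open>N \<subset> M\<close> satisfies_reduct_mono[of P N M]
      by (auto simp: model_def ground_reduct interpretation_of_def)
    ultimately show False using minD by blast
  qed
  with mod have "M \<in> MM P" by (auto simp: MM_def)
  moreover have "M \<subseteq> S_omega (reduct P M)"
    using min by (rule minimal_model_subset_S_omega[rotated])
      (auto simp only: ground_reduct, auto simp: reduct_def)
  ultimately show "M \<in> MF P" using mod by (simp add: MF_def founded_def)
qed

end
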